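(* Let $S_4$ be the size of the open cluster of a uniformly random vertex in bond percolation with parameter $p$ on the graph of the tetrahedron. For all $p\in(0,1)$, $$E(S_4) = 1 + 3p + 6p^2 - 21p^4 + 21p^5 - 6p^6$$ and $$E(S_4^2) = 1 + 9p + 36p^2 + 30p^3 - 171p^4 + 153p^5 - 42p^6.$$
   Context: Bond percolation with parameter $p$ on a finite simple undirected graph $\mathscr{G}=(\mathscr{V},\mathscr{E})$: $(\zeta(e))_{e\in\mathscr{E}}$ are independent Bernoulli($p$) random variables; edge $e$ is open if $\zeta(e)=1$ and closed if $\zeta(e)=0$. For a vertex $x$, the open cluster $\mathscr{C}_x$ is the set of vertices $y\in\mathscr{V}$ such that there is a path of open edges connecting $x$ and $y$ (in particular $x\in\mathscr{C}_x$). The vertex $x$ is chosen uniformly at random in $\mathscr{V}$, independently of the $\zeta(e)$, and the cluster size is $\mathrm{card}(\mathscr{C}_x)$. The graph of the tetrahedron consists of its 4 vertices and 6 edges (the complete graph on 4 vertices). *)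

theory Defs
  imports "HOL-Probability.Probability"
begin

text \<open>
  An undirected graph is given by a vertex set \<open>V\<close> and a set \<open>E\<close> of edges, an edge being the
  two-element set of its endpoints.
\<close>

definition finite_simple_graph :: "'a set \<Rightarrow> 'a set set \<Rightarrow> bool" where
  "finite_simple_graph V E \<longleftrightarrow> finite V \<and> (\<forall>e\<in>E. e \<subseteq> V \<and> card e = 2)"

text \<open>
  A configuration \<open>\<zeta>\<close> maps an edge to \<open>True\<close> (open, the value 1) or \<open>False\<close> (closed, the value 0).
\<close>

definition open_adj :: "'a set set \<Rightarrow> ('a set \<Rightarrow> bool) \<Rightarrow> ('a \<times> 'a) set" where
  "open_adj E \<zeta> = {(u, v). {u, v} \<in> E \<and> \<zeta> {u, v}}"

definition open_cluster :: "'a set \<Rightarrow> 'a set set \<Rightarrow> ('a set \<Rightarrow> bool) \<Rightarrow> 'a \<Rightarrow> 'a set" where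
  "open_cluster V E \<zeta> x = {y \<in> V. (x, y) \<in> (open_adj E \<zeta>)\<^sup>*}"

text \<open>
  The joint law of the uniform vertex and of the independent edge states. The default value
  \<open>False\<close> is the value of \<open>\<zeta>\<close> outside \<open>E\<close>, where it plays no role.
\<close>

definition percolation :: "'a set \<Rightarrow> 'a set set \<Rightarrow> real \<Rightarrow> ('a \<times> ('a set \<Rightarrow> bool)) pmf" where
  "percolation V E p = pair_pmf (pmf_of_set V) (Pi_pmf E False (\<lambda>_. bernoulli_pmf p))"

definition cluster_size :: "'a set \<Rightarrow> 'a set set \<Rightarrow> 'a \<times> ('a set \<Rightarrow> bool) \<Rightarrow> nat" where
  "cluster_size V E = (\<lambda>(x, \<zeta>). card (open_cluster V E \<zeta> x))"

definition tetrahedron_V :: "nat set" where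
  "tetrahedron_V = {0..<4}"

definition tetrahedron_E :: "nat set set" where
  "tetrahedron_E = {e. e \<subseteq> tetrahedron_V \<and> card e = 2}"

lemma finite_simple_graph_tetrahedron: "finite_simple_graph tetrahedron_V tetrahedron_E"
  by (simp add: finite_simple_graph_def tetrahedron_V_def tetrahedron_E_def)

lemma card_tetrahedron_V: "card tetrahedron_V = 4"
  by (simp add: tetrahedron_V_def)

lemma card_tetrahedron_E: "card tetrahedron_E = 6"
  unfolding tetrahedron_E_def
  by (subst n_subsets) (simp_all add: tetrahedron_V_def choose_two)

definition S4 :: "nat \<times> (nat set \<Rightarrow> bool) \<Rightarrow> nat" where
  "S4 = cluster_size tetrahedron_V tetrahedron_E"

end

theory Submission imports Defs begin

text \<open>
  The automorphisms of the tetrahedron act transitively on its vertices, so the cluster size of a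
  random vertex has the same law as that of any fixed vertex \<open>a\<close>. Call the other vertices
  \<open>b\<close>, \<open>c\<close>, \<open>d\<close>. A path without repeated vertices from \<open>a\<close> to \<open>b\<close> passes through a subset of \<open>c\<close>, \<open>d\<close> in
  some order, which leaves five paths; so whether \<open>b\<close> lies in the cluster is an explicit Boolean
  function of the six edge states (\<open>reachable_iff_K4\<close>), and the cluster size is one plus three such
  indicators, one for each of \<open>b\<close>, \<open>c\<close>, \<open>d\<close>. Averaging over the independent edge states one edge
  at a time (\<open>expectation_Pi_bernoulli_insert\<close>) gives the whole law of the cluster size
  (\<open>expectation_cluster_card_K4\<close>). With \<open>q = 1 - p\<close> its weights are
  \<open>q\<^sup>3\<close>, \<open>3 p q\<^sup>4\<close>, \<open>3 p\<^sup>2 (3 - 2 p) q\<^sup>3\<close> and \<open>p\<^sup>3 (16 q\<^sup>3 + 15 p q\<^sup>2 + 6 p\<^sup>2 q + p\<^sup>3)\<close>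
  on the sizes 1, 2, 3 and 4. Each weight is the number of vertex sets of that size containing \<open>a\<close>,
  times the probability that the edges inside such a set connect it, times the probability that all
  edges leaving it are closed. The two moments are read off from this law.

  Symmetry is expressed by proving everything for an arbitrary labelling \<open>a, b, c, d\<close> of the
  vertices: the statement for another vertex is the same statement with the labels permuted.
\<close>

text \<open>
  Fubini for the state of one edge and the remaining states, which is what lets an expectation over
  finitely many edges be evaluated recursively.
\<close>

lemma expectation_Pi_bernoulli_insert:
  fixes g :: "('e \<Rightarrow> bool) \<Rightarrow> real"
  assumes "finite A" and "e \<notin> A"
  shows "measure_pmf.expectation (Pi_pmf (insert e A) False (\<lambda>_. bernoulli_pmf p)) g =
           measure_pmf.expectation (bernoulli_pmf p) (\<lambda>x.
             measure_pmf.expectation (Pi_pmf A False (\<lambda>_. bernoulli_pmf p)) (\<lambda>\<zeta>. g (\<zeta>(e := x))))"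
proof -
  let ?P = "Pi_pmf A False (\<lambda>_. bernoulli_pmf p)"
  have fin: "finite (set_pmf ?P)"
    using assms by (simp add: set_Pi_pmf finite_PiE_dflt)
  have split: "Pi_pmf (insert e A) False (\<lambda>_. bernoulli_pmf p) =
      bernoulli_pmf p \<bind> (\<lambda>y. map_pmf (\<lambda>\<zeta>. \<zeta>(e := y)) ?P)"
    using assms by (simp add: Pi_pmf_insert' map_pmf_def)
  show ?thesis
    unfolding split
    by (subst pmf_expectation_bind[where A = UNIV])
       (use fin in \<open>auto simp: integral_measure_pmf[where A = UNIV]\<close>)
qed

text \<open>
  Iterated expectations keep a single copy of \<open>h\<close>, so a particular \<open>h\<close> can be simplified as the
  states are fixed one after the other, instead of only in a sum over all 64 configurations.
\<close>

lemma expectation_six_edges: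
  fixes h :: "bool \<Rightarrow> bool \<Rightarrow> bool \<Rightarrow> bool \<Rightarrow> bool \<Rightarrow> bool \<Rightarrow> real"
  assumes "distinct [e1, e2, e3, e4, e5, e6]"
  shows "measure_pmf.expectation (Pi_pmf {e1, e2, e3, e4, e5, e6} False (\<lambda>_. bernoulli_pmf p))
             (\<lambda>\<zeta>. h (\<zeta> e1) (\<zeta> e2) (\<zeta> e3) (\<zeta> e4) (\<zeta> e5) (\<zeta> e6)) =
           measure_pmf.expectation (bernoulli_pmf p) (\<lambda>x1.
             measure_pmf.expectation (bernoulli_pmf p) (\<lambda>x2.
               measure_pmf.expectation (bernoulli_pmf p) (\<lambda>x3.
                 measure_pmf.expectation (bernoulli_pmf p) (\<lambda>x4.
                   measure_pmf.expectation (bernoulli_pmf p) (\<lambda>x5.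
                     measure_pmf.expectation (bernoulli_pmf p) (\<lambda>x6. h x1 x2 x3 x4 x5 x6))))))"
proof -
  have neq: "e1 \<noteq> e2" "e1 \<noteq> e3" "e1 \<noteq> e4" "e1 \<noteq> e5" "e1 \<noteq> e6" "e2 \<noteq> e3"
      "e2 \<noteq> e4" "e2 \<noteq> e5" "e2 \<noteq> e6" "e3 \<noteq> e4" "e3 \<noteq> e5" "e3 \<noteq> e6" "e4 \<noteq> e5" "e4 \<noteq> e6" "e5 \<noteq> e6"
    using assms by auto
  show ?thesis
    using neq neq[symmetric] by (simp add: expectation_Pi_bernoulli_insert)
qed

lemma two_subsets_of_four:
  assumes "distinct [a, b, c, d]"
  shows "{e. e \<subseteq> {a, b, c, d} \<and> card e = 2} = {{a, b}, {a, c}, {a, d}, {b, c}, {b, d}, {c, d}}"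
proof (intro set_eqI iffI)
  fix e
  assume "e \<in> {e. e \<subseteq> {a, b, c, d} \<and> card e = 2}"
  then obtain u v where "e = {u, v}" "u \<noteq> v" "u \<in> {a, b, c, d}" "v \<in> {a, b, c, d}"
    by (auto simp: card_2_iff)
  then show "e \<in> {{a, b}, {a, c}, {a, d}, {b, c}, {b, d}, {c, d}}"
    unfolding insert_iff by (elim disjE) (simp_all add: insert_commute)
next
  fix e
  assume "e \<in> {{a, b}, {a, c}, {a, d}, {b, c}, {b, d}, {c, d}}"
  then show "e \<in> {e. e \<subseteq> {a, b, c, d} \<and> card e = 2}"
    using assms unfolding insert_iff by (elim disjE) simp_all
qed

text \<open>
  The disjuncts are the five paths without repeated vertices from \<open>a\<close> to \<open>b\<close>. For necessity, the
  set of vertices that are reached from \<open>a\<close> along such a path contains \<open>a\<close> and cannot be left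
  through an open edge.
\<close>

lemma reachable_iff_K4:
  assumes dist: "distinct [a, b, c, d]"
    and E: "E = {e. e \<subseteq> {a, b, c, d} \<and> card e = 2}"
  shows "(a, b) \<in> (open_adj E \<zeta>)\<^sup>* \<longleftrightarrow>
           \<zeta> {a, b} \<or> \<zeta> {a, c} \<and> \<zeta> {b, c} \<or> \<zeta> {a, d} \<and> \<zeta> {b, d}
           \<or> \<zeta> {a, c} \<and> \<zeta> {c, d} \<and> \<zeta> {b, d} \<or> \<zeta> {a, d} \<and> \<zeta> {c, d} \<and> \<zeta> {b, c}"
    (is "_ \<longleftrightarrow> ?paths b c d")
proof -
  have edge: "(u, v) \<in> open_adj E \<zeta> \<longleftrightarrow>
      u \<in> {a, b, c, d} \<and> v \<in> {a, b, c, d} \<and> u \<noteq> v \<and> \<zeta> {u, v}" for u v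
    unfolding open_adj_def E by (auto simp: card_2_iff doubleton_eq_iff)
  have sym: "{b, a} = {a, b}" "{c, a} = {a, c}" "{d, a} = {a, d}"
      "{c, b} = {b, c}" "{d, b} = {b, d}" "{d, c} = {c, d}"
    by auto
  have "?paths b c d" if "(a, b) \<in> (open_adj E \<zeta>)\<^sup>*"
  proof -
    define R where "R v \<longleftrightarrow> v = a \<or> v = b \<and> ?paths b c d \<or> v = c \<and> ?paths c b d
      \<or> v = d \<and> ?paths d b c" for v
    have R: "R a" "R b \<longleftrightarrow> ?paths b c d" "R c \<longleftrightarrow> ?paths c b d" "R d \<longleftrightarrow> ?paths d b c"
      using dist by (auto simp: R_def)
    have "R v" if "(a, v) \<in> (open_adj E \<zeta>)\<^sup>*" for v
      using that
    proof (induction rule: rtrancl_induct)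
      case base
      show ?case by (fact R(1))
    next
      case (step u v)
      then have "u \<in> {a, b, c, d}" "v \<in> {a, b, c, d}" "\<zeta> {u, v}" "R u"
        by (simp_all add: edge)
      then show ?case
        unfolding insert_iff empty_iff by (elim disjE FalseE) (simp_all add: R sym, argo+)
    qed
    then show ?thesis
      using that R(2) by blast
  qed
  moreover have "(a, b) \<in> (open_adj E \<zeta>)\<^sup>*" if "?paths b c d"
  proof -
    have step: "(u, v) \<in> (open_adj E \<zeta>)\<^sup>*"
      if "\<zeta> {u, v}" "u \<in> {a, b, c, d}" "v \<in> {a, b, c, d}" for u v
      using that edge[of u v] by (cases "u = v") auto
    have "\<zeta> {a, b} \<Longrightarrow> (a, b) \<in> (open_adj E \<zeta>)\<^sup>*" "\<zeta> {a, c} \<Longrightarrow> (a, c) \<in> (open_adj E \<zeta>)\<^sup>*"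
        "\<zeta> {a, d} \<Longrightarrow> (a, d) \<in> (open_adj E \<zeta>)\<^sup>*" "\<zeta> {b, c} \<Longrightarrow> (c, b) \<in> (open_adj E \<zeta>)\<^sup>*"
        "\<zeta> {b, d} \<Longrightarrow> (d, b) \<in> (open_adj E \<zeta>)\<^sup>*" "\<zeta> {c, d} \<Longrightarrow> (c, d) \<in> (open_adj E \<zeta>)\<^sup>*"
        "\<zeta> {c, d} \<Longrightarrow> (d, c) \<in> (open_adj E \<zeta>)\<^sup>*"
      using step[of a b] step[of a c] step[of a d] step[of c b] step[of d b] step[of c d] step[of d c]
      by (simp_all add: sym)
    with that show ?thesis
      by (meson rtrancl_trans)
  qed
  ultimately show ?thesis by blast
qed

text \<open>
  The three indicators are the path conditions for \<open>b\<close>, \<open>c\<close> and \<open>d\<close>, each argument being the state of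
  the edge that it is named after.
\<close>

definition K4_cluster_card ::
  "bool \<Rightarrow> bool \<Rightarrow> bool \<Rightarrow> bool \<Rightarrow> bool \<Rightarrow> bool \<Rightarrow> nat" where
  "K4_cluster_card ab ac ad bc bd cd = 1
      + of_bool (ab \<or> ac \<and> bc \<or> ad \<and> bd \<or> ac \<and> cd \<and> bd \<or> ad \<and> cd \<and> bc)
      + of_bool (ac \<or> ab \<and> bc \<or> ad \<and> cd \<or> ab \<and> bd \<and> cd \<or> ad \<and> bd \<and> bc)
      + of_bool (ad \<or> ab \<and> bd \<or> ac \<and> cd \<or> ab \<and> bc \<and> cd \<or> ac \<and> bc \<and> bd)"

lemma card_open_cluster_K4:
  assumes dist: "distinct [a, b, c, d]"
    and V: "V = {a, b, c, d}" and E: "E = {e. e \<subseteq> V \<and> card e = 2}"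
  shows "card (open_cluster V E \<zeta> a) =
    K4_cluster_card (\<zeta> {a, b}) (\<zeta> {a, c}) (\<zeta> {a, d}) (\<zeta> {b, c}) (\<zeta> {b, d}) (\<zeta> {c, d})"
proof -
  let ?r = "\<lambda>y. (a, y) \<in> (open_adj E \<zeta>)\<^sup>*"
  have B: "?r b \<longleftrightarrow> \<zeta> {a, b} \<or> \<zeta> {a, c} \<and> \<zeta> {b, c} \<or> \<zeta> {a, d} \<and> \<zeta> {b, d}
          \<or> \<zeta> {a, c} \<and> \<zeta> {c, d} \<and> \<zeta> {b, d} \<or> \<zeta> {a, d} \<and> \<zeta> {c, d} \<and> \<zeta> {b, c}"
    using dist by (intro reachable_iff_K4) (auto simp: E V)
  have C: "?r c \<longleftrightarrow> \<zeta> {a, c} \<or> \<zeta> {a, b} \<and> \<zeta> {b, c} \<or> \<zeta> {a, d} \<and> \<zeta> {c, d}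
          \<or> \<zeta> {a, b} \<and> \<zeta> {b, d} \<and> \<zeta> {c, d} \<or> \<zeta> {a, d} \<and> \<zeta> {b, d} \<and> \<zeta> {b, c}"
    using dist by (subst reachable_iff_K4[of a c b d]) (auto simp: E V insert_commute)
  have D: "?r d \<longleftrightarrow> \<zeta> {a, d} \<or> \<zeta> {a, b} \<and> \<zeta> {b, d} \<or> \<zeta> {a, c} \<and> \<zeta> {c, d}
          \<or> \<zeta> {a, b} \<and> \<zeta> {b, c} \<and> \<zeta> {c, d} \<or> \<zeta> {a, c} \<and> \<zeta> {b, c} \<and> \<zeta> {b, d}"
    using dist by (subst reachable_iff_K4[of a d b c]) (auto simp: E V insert_commute)
  have "open_cluster V E \<zeta> a =
      {a} \<union> (if ?r b then {b} else {}) \<union> (if ?r c then {c} else {}) \<union> (if ?r d then {d} else {})"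
    unfolding open_cluster_def V by auto
  then have "card (open_cluster V E \<zeta> a) = 1 + of_bool (?r b) + of_bool (?r c) + of_bool (?r d)"
    \<comment> \<open>The reversed list supplies each inequality in the other orientation.\<close>
    using dist distinct_rev[of "[a, b, c, d]"] by (cases "?r b"; cases "?r c"; cases "?r d") simp_all
  then show ?thesis
    unfolding B C D K4_cluster_card_def .
qed

text \<open>
  The law of the cluster size of \<open>a\<close>, in terms of an arbitrary test function so that both moments
  are instances.
\<close>

lemma expectation_cluster_card_K4:
  fixes f :: "nat \<Rightarrow> real"
  assumes dist: "distinct [a, b, c, d]"
    and V: "V = {a, b, c, d}" and E: "E = {e. e \<subseteq> V \<and> card e = 2}"
    and p: "0 \<le> p" "p \<le> 1"
  shows "measure_pmf.expectation (Pi_pmf E False (\<lambda>_. bernoulli_pmf p))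
             (\<lambda>\<zeta>. f (card (open_cluster V E \<zeta> a))) =
           (1 - p) ^ 3 * f 1
           + 3 * p * (1 - p) ^ 4 * f 2
           + 3 * p ^ 2 * (3 - 2 * p) * (1 - p) ^ 3 * f 3
           + p ^ 3 * (16 * (1 - p) ^ 3 + 15 * p * (1 - p) ^ 2 + 6 * p ^ 2 * (1 - p) + p ^ 3) * f 4"
proof -
  have edges: "E = {{a, b}, {a, c}, {a, d}, {b, c}, {b, d}, {c, d}}"
    unfolding E V by (rule two_subsets_of_four[OF dist])
  have dist_edges: "distinct [{a, b}, {a, c}, {a, d}, {b, c}, {b, d}, {c, d}]"
    using dist by (auto simp: doubleton_eq_iff)
  define q where "q = 1 - p"
  \<comment> \<open>Merges the two branches of an edge whose state no longer influences the cluster size.\<close>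
  have merge: "x * p + x * q = x" for x
    by (simp add: q_def algebra_simps)
  \<comment> \<open>The sizes come out of the evaluation as successors.\<close>
  have sizes: "f 2 = f (Suc (Suc 0))" "f 3 = f (Suc (Suc (Suc 0)))" "f 4 = f (Suc (Suc (Suc (Suc 0))))"
    by (simp_all add: numeral_eq_Suc)
  show ?thesis
    unfolding card_open_cluster_K4[OF dist V E]
    unfolding edges expectation_six_edges[OF dist_edges,
        where h = "\<lambda>ab ac ad bc bd cd. f (K4_cluster_card ab ac ad bc bd cd)"]
    apply (simp only: integral_bernoulli_pmf p q_def[symmetric])
    apply (simp add: K4_cluster_card_def merge sizes)
    apply (simp add: q_def)
    apply (simp add: algebra_simps power_numeral_reduce)
    done
qed

theorem theorem3:
  fixes p :: real
  assumes "0 < p" and "p < 1"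
  shows "measure_pmf.expectation (percolation tetrahedron_V tetrahedron_E p) (\<lambda>\<omega>. real (S4 \<omega>))
           = 1 + 3 * p + 6 * p ^ 2 - 21 * p ^ 4 + 21 * p ^ 5 - 6 * p ^ 6
       \<and> measure_pmf.expectation (percolation tetrahedron_V tetrahedron_E p) (\<lambda>\<omega>. real (S4 \<omega>) ^ 2)
           = 1 + 9 * p + 36 * p ^ 2 + 30 * p ^ 3 - 171 * p ^ 4 + 153 * p ^ 5 - 42 * p ^ 6"
proof -
  let ?V = tetrahedron_V and ?E = tetrahedron_E
  let ?P = "Pi_pmf ?E False (\<lambda>_. bernoulli_pmf p)"
  define law where "law f = (1 - p) ^ 3 * f 1 + 3 * p * (1 - p) ^ 4 * f 2
      + 3 * p ^ 2 * (3 - 2 * p) * (1 - p) ^ 3 * f 3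
      + p ^ 3 * (16 * (1 - p) ^ 3 + 15 * p * (1 - p) ^ 2 + 6 * p ^ 2 * (1 - p) + p ^ 3) * f 4"
    for f :: "nat \<Rightarrow> real"
  have fixed: "measure_pmf.expectation ?P (\<lambda>\<zeta>. f (S4 (x, \<zeta>))) = law f"
    if x: "x \<in> ?V" for x and f :: "nat \<Rightarrow> real"
  proof -
    \<comment> \<open>Transitivity of the symmetry group: any vertex can come first in a labelling.\<close>
    have "\<exists>b c d. distinct [x, b, c, d] \<and> ?V = {x, b, c, d}"
    proof -
      have "card (?V - {x}) = 3"
        using x by (simp add: card_tetrahedron_V)
      then obtain b c d where others: "?V - {x} = {b, c, d}" and "b \<noteq> c" "b \<noteq> d" "c \<noteq> d"
        by (auto simp: card_3_iff)
      moreover have "x \<notin> {b, c, d}"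
        using others by blast
      moreover have "?V = {x, b, c, d}"
        using others x by blast
      ultimately show ?thesis
        by (intro exI[of _ b] exI[of _ c] exI[of _ d]) simp
    qed
    then obtain b c d where "distinct [x, b, c, d]" "?V = {x, b, c, d}" by blast
    then show ?thesis
      using assms
      unfolding S4_def cluster_size_def law_def prod.case
      by (intro expectation_cluster_card_K4) (auto simp: tetrahedron_E_def)
  qed
  have random: "measure_pmf.expectation (percolation ?V ?E p) (\<lambda>\<omega>. f (S4 \<omega>)) = law f"
    for f :: "nat \<Rightarrow> real"
  proof -
    have fin: "finite (set_pmf ?P)"
      by (simp add: set_Pi_pmf finite_PiE_dflt tetrahedron_E_def tetrahedron_V_def)
    have "percolation ?V ?E p = pmf_of_set ?V \<bind> (\<lambda>x. map_pmf (Pair x) ?P)"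
      by (simp add: percolation_def pair_pmf_def map_pmf_def)
    then have "measure_pmf.expectation (percolation ?V ?E p) (\<lambda>\<omega>. f (S4 \<omega>))
        = (\<Sum>x\<in>?V. measure_pmf.expectation ?P (\<lambda>\<zeta>. f (S4 (x, \<zeta>))) /\<^sub>R real (card ?V))"
      using fin by (simp add: pmf_expectation_bind_pmf_of_set tetrahedron_V_def)
    also have "\<dots> = law f"
      by (simp add: fixed card_tetrahedron_V)
    finally show ?thesis .
  qed
  show ?thesis
    using random[of real] random[of "\<lambda>n. real n ^ 2"]
    by (simp add: law_def numeral_eq_Suc algebra_simps)
qed

end
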